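(* Let $\bm{x}$ be a sequence taking values in a topological space $X$, let $\mathcal{I}$ be an ideal on $\omega$, and let $\mathscr{F}=\{F_\eta:\eta\in X\}$ be a rough family on $X$ made of closed sets. Suppose that the map $X\to\mathcal{H}(X)$, $\eta\mapsto F_\eta$, is $\widehat{\tau}$-continuous. Then $\Gamma_{\bm{x}}(\mathcal{I},\mathscr{F})$ is a closed subset of $X$.
   Context: $\omega$ is the set of nonnegative integers. An ideal $\mathcal{I}$ on $\omega$ is a family $\mathcal{I}\subseteq\mathcal{P}(\omega)$ closed under subsets and finite unions, containing all finite subsets of $\omega$, and with $\omega\notin\mathcal{I}$. A rough family on a topological space $X$ is a collection $\mathscr{F}=\{F_\eta:\eta\in X\}$ of subsets of $X$ such that $\eta\in F_\eta$ for all $\eta\in X$. For a sequence $\bm{x}=(x_n:n\in\omega)$ in $X$, $\Gamma_{\bm{x}}(\mathcal{I},\mathscr{F})$ is the set of all $\eta\in X$ such that $\{n\in\omega:x_n\in U\}\notin\mathcal{I}$ for all open sets $U\subseteq X$ with $F_\eta\subseteq U$. $\mathcal{H}(X)$ is the family of nonempty closed subsets of $X$, endowed with the upper Vietoris topology $\widehat{\tau}$, i.e. the topology generated by the base of sets $\{F\in\mathcal{H}(X):F\subseteq U\}$ with $U\subseteq X$ open. A map into $\mathcal{H}(X)$ is $\widehat{\tau}$-continuous if it is continuous with respect to $\widehat{\tau}$. *)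

theory Defs
  imports "HOL-Analysis.Analysis"
begin

definition ideal_on_nat :: "nat set set \<Rightarrow> bool" where
  "ideal_on_nat I \<longleftrightarrow>
     (\<forall>A B. A \<in> I \<and> B \<subseteq> A \<longrightarrow> B \<in> I) \<and>
     (\<forall>A B. A \<in> I \<and> B \<in> I \<longrightarrow> A \<union> B \<in> I) \<and>
     (\<forall>A. finite A \<longrightarrow> A \<in> I) \<and>
     UNIV \<notin> I"

text \<open>A rough family is rendered as an indexed family; only its values on the carrier
  of the space matter.\<close>

definition rough_family :: "'a topology \<Rightarrow> ('a \<Rightarrow> 'a set) \<Rightarrow> bool" where
  "rough_family X F \<longleftrightarrow> (\<forall>\<eta>\<in>topspace X. F \<eta> \<subseteq> topspace X \<and> \<eta> \<in> F \<eta>)"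

definition rough_cluster_points ::
    "'a topology \<Rightarrow> (nat \<Rightarrow> 'a) \<Rightarrow> nat set set \<Rightarrow> ('a \<Rightarrow> 'a set) \<Rightarrow> 'a set" where
  "rough_cluster_points X x I F =
     {\<eta> \<in> topspace X. \<forall>U. openin X U \<and> F \<eta> \<subseteq> U \<longrightarrow> {n. x n \<in> U} \<notin> I}"

definition closed_hyperspace :: "'a topology \<Rightarrow> 'a set set" where
  "closed_hyperspace X = {C. closedin X C \<and> C \<noteq> {}}"

text \<open>The generating sets are closed under finite intersections and include the whole
  hyperspace (take \<open>U = topspace X\<close>), so they form a base of the generated topology
  and not merely a subbase.\<close>

definition upper_vietoris :: "'a topology \<Rightarrow> 'a set topology" where
  "upper_vietoris X =
     topology_generated_by {{C \<in> closed_hyperspace X. C \<subseteq> U} | U. openin X U}"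

lemma topspace_upper_vietoris: "topspace (upper_vietoris X) = closed_hyperspace X"
proof -
  have "closed_hyperspace X \<subseteq> {C \<in> closed_hyperspace X. C \<subseteq> topspace X}"
    by (auto simp: closed_hyperspace_def dest: closedin_subset)
  then show ?thesis
    unfolding upper_vietoris_def topology_generated_by_topspace
    using openin_topspace[of X] by blast
qed

end

theory Submission
  imports Defs
begin

text \<open>The complement is open. If \<eta> is not a cluster point, some open \<open>U\<close>
  contains \<open>F \<eta>\<close> while the indices \<open>n\<close> with \<open>x n\<close> in
  \<open>U\<close> form a set in \<open>I\<close>. This same \<open>U\<close> rules out every point
  whose value under \<open>F\<close> lies inside \<open>U\<close>, and by upper Vietoris continuity
  these points form an open set (\<open>openin_subset_preimage\<close>).\<close>

lemma openin_upper_vietoris_base: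
  assumes "openin X U"
  shows "openin (upper_vietoris X) {C \<in> closed_hyperspace X. C \<subseteq> U}"
  unfolding upper_vietoris_def
  by (rule topology_generated_by_Basis) (use assms in blast)

text \<open>This is the preimage of a basic open set: a continuous map takes its values in
  \<open>closed_hyperspace X\<close>, so only the inclusion in \<open>U\<close> remains as a
  condition.\<close>

lemma openin_subset_preimage:
  assumes "continuous_map Y (upper_vietoris X) F" and "openin X U"
  shows "openin Y {\<eta> \<in> topspace Y. F \<eta> \<subseteq> U}"
proof -
  have "F \<eta> \<in> closed_hyperspace X" if "\<eta> \<in> topspace Y" for \<eta>
    using continuous_map_image_subset_topspace[OF assms(1)] that
    by (auto simp: topspace_upper_vietoris)
  then have "{\<eta> \<in> topspace Y. F \<eta> \<subseteq> U} =
      {\<eta> \<in> topspace Y. F \<eta> \<in> {C \<in> closed_hyperspace X. C \<subseteq> U}}"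
    by blast
  then show ?thesis
    using openin_continuous_map_preimage[OF assms(1) openin_upper_vietoris_base[OF assms(2)]]
    by simp
qed

theorem theorem2p7:
  fixes X :: "'a topology" and x :: "nat \<Rightarrow> 'a"
    and I :: "nat set set" and F :: "'a \<Rightarrow> 'a set"
  assumes "range x \<subseteq> topspace X"
    and "ideal_on_nat I"
    and "rough_family X F"
    and "\<And>\<eta>. \<eta> \<in> topspace X \<Longrightarrow> closedin X (F \<eta>)"
    and "continuous_map X (upper_vietoris X) F"
  shows "closedin X (rough_cluster_points X x I F)"
proof -
  \<comment> \<open>Negating the universal condition on \<open>U\<close> gives a union over the
    witnesses \<open>U\<close>.\<close>
  have "topspace X - rough_cluster_points X x I F =
      (\<Union>U \<in> {U. openin X U \<and> {n. x n \<in> U} \<in> I}. {\<eta> \<in> topspace X. F \<eta> \<subseteq> U})"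
    unfolding rough_cluster_points_def by blast
  moreover have "openin X \<dots>"
    using openin_subset_preimage[OF assms(5)] by (intro openin_Union) blast
  ultimately show ?thesis
    unfolding closedin_def by (auto simp: rough_cluster_points_def)
qed

end
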